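(* Let the spaces, forms, smoothers, the parameter-dependent quantity $\rho(M)$, and the conditions (L1)--(L3), (SP), (SQ), (SR), (H), (QO) be as described in the context. (a) Suppose (L1)--(L3), (SP), (SQ), (SR), (H), and $M\ge 0$. Then $$\|u-v_h\|_{\widehat X}\le C_{\rm rel}\Big(\rho(M)+(1+M)\,\|(1-P)v_h\|_{\widehat X}+M\,\|u_h-v_h\|_{X_h}\Big).$$ The constant $C_{\rm rel}$ exclusively depends on $\beta$, $(1-\kappa)^{-1}$, $\Lambda_{\rm C}$, $\Lambda_{\rm P}$, $\Lambda_{\rm R}$, $\|a_h\|$, $\|\Gamma\|$, $\|\Gamma_{\rm pw}\|$, $\|S\|$, and $\|u\|_X$. (b) Suppose (L1)--(L2) and (QO). Then $\rho(M)\le\rho(0)$ and $$\rho(0)+\|(1-P)v_h\|_{\widehat X}+\|u_h-v_h\|_{X_h}\le C_{\rm eff}\,\|u-v_h\|_{\widehat X}.$$ The constant $C_{\rm eff}$ exclusively depends on $\beta$, $(1-\kappa)^{-1}$, $\Lambda_{\rm C}$, $\Lambda_{\rm P}$, $\Lambda_{\rm R}$, $\|a_h\|$, $\|\Gamma\|$, $\|\Gamma_{\rm pw}\|$, $\|S\|$, $\|u\|_X$, and $C_{\rm qo}$.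
   Context: **Spaces.** $\widehat X$, $\widehat Y$ are real Banach spaces; $X,X_h\subseteq\widehat X$ and $Y,Y_h\subseteq\widehat Y$ are complete linear subspaces with the inherited norms $\|\cdot\|_X,\|\cdot\|_{X_h}$ (restrictions of $\|\cdot\|_{\widehat X}$) and $\|\cdot\|_Y,\|\cdot\|_{Y_h}$ (restrictions of $\|\cdot\|_{\widehat Y}$), so that $X+X_h\subseteq\widehat X$ and $Y+Y_h\subseteq\widehat Y$. In general $X_h\not\subset X$. **Continuous problem.** $a:X\times Y\to\mathbb R$ is a bounded bilinear form whose associated operator $A\in L(X;Y^* )$ is invertible; in particular $0<\alpha:=\inf_{\|x\|_X=1}\sup_{\|y\|_Y=1}a(x,y)$. $\Gamma_{\rm pw}:\widehat X\times\widehat X\times\widehat Y\to\mathbb R$ is a bounded trilinear form with norm $\|\Gamma_{\rm pw}\|$, and $\Gamma:=\Gamma_{\rm pw}|_{X\times X\times Y}$ has norm $\|\Gamma\|$. Given $F\in Y^*$, define $N:X\to Y^*$ by $N(x):=a(x,\cdot)+\Gamma(x,x,\cdot)-F$. A vector $u\in X$ is a *regular root* if $N(u)=0$ and the Fréchet derivative $DN(u)$ is a bijection; in particular $$0<\beta:=\inf_{\|x\|_X=1}\ \sup_{\|y\|_Y=1}\big(a(x,y)+\Gamma(u,x,y)+\Gamma(x,u,y)\big).$$ **Discrete problem.** $a_h:X_h\times Y_h\to\mathbb R$ is a bounded bilinear form with norm $\|a_h\|$ and $0<\alpha_h:=\inf_{\|x_h\|_{X_h}=1}\sup_{\|y_h\|_{Y_h}=1}a_h(x_h,y_h)$.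 The smoothers are bounded linear operators $P\in L(X_h;X)$, $Q\in L(Y_h;Y)$, $R\in L(X_h;\widehat X)$, $S\in L(Y_h;\widehat Y)$ with operator norms $\|P\|,\|Q\|,\|R\|,\|S\|$. As a standing assumption there are constants $\Lambda_{\rm P},\Lambda_{\rm Q},\Lambda_{\rm R},\Lambda_{\rm S}\ge0$ such that for all $x_h\in X_h$, $x\in X$, $y_h\in Y_h$, $y\in Y$: - (SP) $\|(1-P)x_h\|_{\widehat X}\le\Lambda_{\rm P}\|x-x_h\|_{\widehat X}$; - (SQ) $\|(1-Q)y_h\|_{\widehat Y}\le\Lambda_{\rm Q}\|y-y_h\|_{\widehat Y}$; - (SR) $\|(1-R)x_h\|_{\widehat X}\le\Lambda_{\rm R}\|x-x_h\|_{\widehat X}$; - (SS) $\|(1-S)y_h\|_{\widehat Y}\le\Lambda_{\rm S}\|y-y_h\|_{\widehat Y}$. (H): there is $\Lambda_{\rm C}>0$ with $a(Px_h,Qy_h)-a_h(x_h,y_h)\le\Lambda_{\rm C}\|x_h-Px_h\|_{\widehat X}\|y_h\|_{Y_h}$ for all $(x_h,y_h)\in X_h\times Y_h$. Define $N_h:X_h\to Y_h^*$ by $N_h(x_h;y_h):=a_h(x_h,y_h)+\Gamma_{\rm pw}(Rx_h,Rx_h,Sy_h)-F(Qy_h)$. **Local conditions (L).** $u\in X$ denotes a regular root of $N$ for the given $F\in Y^*$, and there exist $\varepsilon,\varrho>0$ and $0<\kappa<1$ for which the following conditions are formulated: - (L1) $N_h(u_h)=0$ holds for exactly one solution $u_h\in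 X_h$ with $\|u-u_h\|_{\widehat X}\le\varepsilon$; - (L2) $v_h\in X_h$ satisfies $\|u_h-v_h\|_{X_h}\le\varrho$; - (L3) $\varepsilon+\varrho\le\kappa\beta/\big((1+\Lambda_{\rm P})\|\Gamma\|\big)$. (QO): $\|u-u_h\|_{\widehat X}\le C_{\rm qo}\min_{x_h\in X_h}\|u-x_h\|_{\widehat X}$ with a constant $C_{\rm qo}>0$. **Intermediate residual.** For $M\ge0$, $$\rho(M):=\sup_{\substack{y\in Y\\ \|y\|_Y\le1}}\ \inf_{\substack{y_h\in Y_h\\ \|y_h\|_{Y_h}\le M}}\Big(F(y-Qy_h)-a(Pv_h,y-Qy_h)-\Gamma_{\rm pw}(Rv_h,Rv_h,y-Sy_h)\Big).$$
   Formalization: As stated it is false: in (a) ρ(M) may be negative and is replaced by max(0, ρ(M)); in (b) C_eff must also depend on ‖a‖, and without (L3) on ε+ϱ too. The constants are uniform over subspaces of fixed ambient spaces (ℓ^∞-sums give full uniformity). *)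

theory Defs
  imports "HOL-Analysis.Analysis"
begin

section \<open>Bounded (multi)linear maps on subspaces\<close>

text \<open>
  The subspaces \<open>X, X\<^sub>h\<close> of \<open>\<^bold>X\<close> (a type of class \<open>banach\<close>) and \<open>Y, Y\<^sub>h\<close> of \<open>\<^bold>Y\<close> are carrier
  sets.  Maps defined on them are total functions whose values off the carrier are irrelevant.
\<close>

definition linear_map_on :: "'a::real_vector set \<Rightarrow> ('a \<Rightarrow> 'b::real_vector) \<Rightarrow> bool" where
  "linear_map_on V f \<longleftrightarrow>
     (\<forall>x\<in>V. \<forall>y\<in>V. f (x + y) = f x + f y) \<and> (\<forall>c. \<forall>x\<in>V. f (c *\<^sub>R x) = c *\<^sub>R f x)"

definition bounded_linear_map_on ::
    "'a::real_normed_vector set \<Rightarrow> ('a \<Rightarrow> 'b::real_normed_vector) \<Rightarrow> bool" where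
  "bounded_linear_map_on V f \<longleftrightarrow>
     linear_map_on V f \<and> (\<exists>K. \<forall>x\<in>V. norm (f x) \<le> K * norm x)"

definition bounded_bilinear_form_on ::
    "'a::real_normed_vector set \<Rightarrow> 'b::real_normed_vector set \<Rightarrow> ('a \<Rightarrow> 'b \<Rightarrow> real) \<Rightarrow> bool" where
  "bounded_bilinear_form_on V W b \<longleftrightarrow>
     (\<forall>y\<in>W. linear_map_on V (\<lambda>x. b x y)) \<and> (\<forall>x\<in>V. linear_map_on W (b x)) \<and>
     (\<exists>K. \<forall>x\<in>V. \<forall>y\<in>W. \<bar>b x y\<bar> \<le> K * norm x * norm y)"

definition bounded_trilinear_form_on ::
    "'a::real_normed_vector set \<Rightarrow> 'b::real_normed_vector set \<Rightarrow> 'c::real_normed_vector set \<Rightarrow>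
     ('a \<Rightarrow> 'b \<Rightarrow> 'c \<Rightarrow> real) \<Rightarrow> bool" where
  "bounded_trilinear_form_on U V W g \<longleftrightarrow>
     (\<forall>v\<in>V. \<forall>w\<in>W. linear_map_on U (\<lambda>x. g x v w)) \<and>
     (\<forall>u\<in>U. \<forall>w\<in>W. linear_map_on V (\<lambda>x. g u x w)) \<and>
     (\<forall>u\<in>U. \<forall>v\<in>V. linear_map_on W (g u v)) \<and>
     (\<exists>K. \<forall>u\<in>U. \<forall>v\<in>V. \<forall>w\<in>W. \<bar>g u v w\<bar> \<le> K * norm u * norm v * norm w)"

definition unit_ball_on :: "'a::real_normed_vector set \<Rightarrow> 'a set" where
  "unit_ball_on V = {x \<in> V. norm x \<le> 1}"

definition unit_sphere_on :: "'a::real_normed_vector set \<Rightarrow> 'a set" where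
  "unit_sphere_on V = {x \<in> V. norm x = 1}"

definition linear_norm_on ::
    "'a::real_normed_vector set \<Rightarrow> ('a \<Rightarrow> 'b::real_normed_vector) \<Rightarrow> real" where
  "linear_norm_on V f = (SUP x\<in>unit_ball_on V. norm (f x))"

definition bilinear_norm_on ::
    "'a::real_normed_vector set \<Rightarrow> 'b::real_normed_vector set \<Rightarrow> ('a \<Rightarrow> 'b \<Rightarrow> real) \<Rightarrow> real" where
  "bilinear_norm_on V W b = (SUP (x, y)\<in>unit_ball_on V \<times> unit_ball_on W. \<bar>b x y\<bar>)"

definition trilinear_norm_on ::
    "'a::real_normed_vector set \<Rightarrow> 'b::real_normed_vector set \<Rightarrow> 'c::real_normed_vector set \<Rightarrow>
     ('a \<Rightarrow> 'b \<Rightarrow> 'c \<Rightarrow> real) \<Rightarrow> real" where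
  "trilinear_norm_on U V W g =
     (SUP (u, v, w)\<in>unit_ball_on U \<times> unit_ball_on V \<times> unit_ball_on W. \<bar>g u v w\<bar>)"

text \<open>Extensionality makes two functionals equal as soon as they agree on \<open>V\<close>.\<close>

definition dual_space :: "'a::real_normed_vector set \<Rightarrow> ('a \<Rightarrow> real) set" where
  "dual_space V = {f \<in> extensional V. bounded_linear_map_on V f}"

text \<open>
  Values in \<open>ereal\<close>, so that the infimum over an empty sphere is \<open>\<infinity>\<close> and the supremum over an
  empty sphere is \<open>-\<infinity>\<close>.
\<close>

definition inf_sup ::
    "'a::real_normed_vector set \<Rightarrow> 'b::real_normed_vector set \<Rightarrow> ('a \<Rightarrow> 'b \<Rightarrow> real) \<Rightarrow> ereal" where
  "inf_sup V W b = (INF x\<in>unit_sphere_on V. SUP y\<in>unit_sphere_on W. ereal (b x y))"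


section \<open>The continuous problem\<close>

definition residual ::
    "'y set \<Rightarrow> ('x \<Rightarrow> 'y \<Rightarrow> real) \<Rightarrow> ('x \<Rightarrow> 'x \<Rightarrow> 'y \<Rightarrow> real) \<Rightarrow> ('y \<Rightarrow> real) \<Rightarrow> 'x \<Rightarrow> 'y \<Rightarrow> real" where
  "residual Y a \<Gamma> F x = (\<lambda>y\<in>Y. a x y + \<Gamma> x x y - F y)"

text \<open>
  Frechet differentiability at \<open>u\<close> of a map \<open>N\<close> from \<open>X\<close> to the dual of \<open>Y\<close>.  A bounded linear
  operator \<open>D\<close> from \<open>X\<close> to the dual of \<open>Y\<close> is the same thing as a bounded bilinear form.
\<close>

definition has_frechet_derivative_dual ::
    "'x::real_normed_vector set \<Rightarrow> 'y::real_normed_vector set \<Rightarrow>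
     ('x \<Rightarrow> 'y \<Rightarrow> real) \<Rightarrow> ('x \<Rightarrow> 'y \<Rightarrow> real) \<Rightarrow> 'x \<Rightarrow> bool" where
  "has_frechet_derivative_dual X Y N D u \<longleftrightarrow>
     bounded_bilinear_form_on X Y D \<and>
     ((\<lambda>x. linear_norm_on Y (\<lambda>y. N x y - N u y - D (x - u) y) / norm (x - u)) \<longlongrightarrow> 0)
       (at u within X)"

definition regular_root ::
    "'x::real_normed_vector set \<Rightarrow> 'y::real_normed_vector set \<Rightarrow> ('x \<Rightarrow> 'y \<Rightarrow> real) \<Rightarrow> 'x \<Rightarrow> bool" where
  "regular_root X Y N u \<longleftrightarrow>
     u \<in> X \<and> (\<forall>y\<in>Y. N u y = 0) \<and>
     (\<exists>D. has_frechet_derivative_dual X Y N D u \<and>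
          bij_betw (\<lambda>x. \<lambda>y\<in>Y. D x y) X (dual_space Y))"

text \<open>
  The inf-sup constant of the derivative of the residual at \<open>u\<close>.  It is finite unless \<open>X = {0}\<close>
  or \<open>Y = {0}\<close>.
\<close>

definition beta ::
    "'x::real_normed_vector set \<Rightarrow> 'y::real_normed_vector set \<Rightarrow>
     ('x \<Rightarrow> 'y \<Rightarrow> real) \<Rightarrow> ('x \<Rightarrow> 'x \<Rightarrow> 'y \<Rightarrow> real) \<Rightarrow> 'x \<Rightarrow> real" where
  "beta X Y a \<Gamma> u = real_of_ereal (inf_sup X Y (\<lambda>x y. a x y + \<Gamma> u x y + \<Gamma> x u y))"


section \<open>The discrete problem\<close>

text \<open>
  The form \<open>\<Gamma>\<close> is the piecewise form on all of \<open>\<^bold>X \<times> \<^bold>X \<times> \<^bold>Y\<close>; its restriction to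
  \<open>X \<times> X \<times> Y\<close> is the trilinear form of the continuous problem.  Invertibility of the operator
  associated with \<open>a\<close> is bijectivity onto the dual space: the inverse is then bounded by the
  bounded inverse theorem.
\<close>

locale semilinear_scheme =
  fixes X Xh :: "'x::banach set" and Y Yh :: "'y::banach set"
    and a :: "'x \<Rightarrow> 'y \<Rightarrow> real"
    and \<Gamma> :: "'x \<Rightarrow> 'x \<Rightarrow> 'y \<Rightarrow> real"
    and F :: "'y \<Rightarrow> real"
    and ah :: "'x \<Rightarrow> 'y \<Rightarrow> real"
    and P :: "'x \<Rightarrow> 'x" and Q :: "'y \<Rightarrow> 'y" and R :: "'x \<Rightarrow> 'x" and S :: "'y \<Rightarrow> 'y"
    and \<Lambda>P \<Lambda>Q \<Lambda>R \<Lambda>S :: real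
  assumes subspaces: "subspace X" "subspace Xh" "subspace Y" "subspace Yh"
    and complete: "complete X" "complete Xh" "complete Y" "complete Yh"
    and a_bounded: "bounded_bilinear_form_on X Y a"
    and a_invertible: "bij_betw (\<lambda>x. \<lambda>y\<in>Y. a x y) X (dual_space Y)"
    and \<Gamma>_bounded: "bounded_trilinear_form_on UNIV UNIV UNIV \<Gamma>"
    and F_dual: "F \<in> dual_space Y"
    and ah_bounded: "bounded_bilinear_form_on Xh Yh ah"
    and ah_inf_sup: "0 < inf_sup Xh Yh ah"
    and P_smoother: "bounded_linear_map_on Xh P" "P ` Xh \<subseteq> X"
    and Q_smoother: "bounded_linear_map_on Yh Q" "Q ` Yh \<subseteq> Y"
    and R_smoother: "bounded_linear_map_on Xh R"
    and S_smoother: "bounded_linear_map_on Yh S"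
    and \<Lambda>_nonneg: "0 \<le> \<Lambda>P" "0 \<le> \<Lambda>Q" "0 \<le> \<Lambda>R" "0 \<le> \<Lambda>S"
    and SP: "\<And>xh x. xh \<in> Xh \<Longrightarrow> x \<in> X \<Longrightarrow> norm (xh - P xh) \<le> \<Lambda>P * norm (x - xh)"
    and SQ: "\<And>yh y. yh \<in> Yh \<Longrightarrow> y \<in> Y \<Longrightarrow> norm (yh - Q yh) \<le> \<Lambda>Q * norm (y - yh)"
    and SR: "\<And>xh x. xh \<in> Xh \<Longrightarrow> x \<in> X \<Longrightarrow> norm (xh - R xh) \<le> \<Lambda>R * norm (x - xh)"
    and SS: "\<And>yh y. yh \<in> Yh \<Longrightarrow> y \<in> Y \<Longrightarrow> norm (yh - S yh) \<le> \<Lambda>S * norm (y - yh)"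

definition discrete_residual ::
    "'y set \<Rightarrow> ('x \<Rightarrow> 'y \<Rightarrow> real) \<Rightarrow> ('x \<Rightarrow> 'x \<Rightarrow> 'y \<Rightarrow> real) \<Rightarrow> ('y \<Rightarrow> real) \<Rightarrow>
     ('y \<Rightarrow> 'y) \<Rightarrow> ('x \<Rightarrow> 'x) \<Rightarrow> ('y \<Rightarrow> 'y) \<Rightarrow> 'x \<Rightarrow> 'y \<Rightarrow> real" where
  "discrete_residual Yh ah \<Gamma> F Q R S xh =
     (\<lambda>yh\<in>Yh. ah xh yh + \<Gamma> (R xh) (R xh) (S yh) - F (Q yh))"

definition cond_H ::
    "'x::real_normed_vector set \<Rightarrow> 'y::real_normed_vector set \<Rightarrow> ('x \<Rightarrow> 'y \<Rightarrow> real) \<Rightarrow>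
     ('x \<Rightarrow> 'y \<Rightarrow> real) \<Rightarrow> ('x \<Rightarrow> 'x) \<Rightarrow> ('y \<Rightarrow> 'y) \<Rightarrow> real \<Rightarrow> bool" where
  "cond_H Xh Yh a ah P Q \<Lambda>C \<longleftrightarrow>
     0 < \<Lambda>C \<and>
     (\<forall>xh\<in>Xh. \<forall>yh\<in>Yh. a (P xh) (Q yh) - ah xh yh \<le> \<Lambda>C * norm (xh - P xh) * norm yh)"

definition cond_L1 ::
    "'x::real_normed_vector set \<Rightarrow> 'y set \<Rightarrow> ('x \<Rightarrow> 'y \<Rightarrow> real) \<Rightarrow> 'x \<Rightarrow> 'x \<Rightarrow> real \<Rightarrow> bool" where
  "cond_L1 Xh Yh Nh u uh \<epsilon> \<longleftrightarrow>
     (let root = (\<lambda>x. x \<in> Xh \<and> (\<forall>yh\<in>Yh. Nh x yh = 0) \<and> norm (u - x) \<le> \<epsilon>)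
      in root uh \<and> (\<forall>x. root x \<longrightarrow> x = uh))"

definition cond_L2 :: "'x::real_normed_vector set \<Rightarrow> 'x \<Rightarrow> 'x \<Rightarrow> real \<Rightarrow> bool" where
  "cond_L2 Xh uh vh \<rho> \<longleftrightarrow> vh \<in> Xh \<and> norm (uh - vh) \<le> \<rho>"

text \<open>
  The right-hand side only makes sense if the restricted form \<open>\<Gamma>\<close> does not vanish.  With
  \<open>x / 0 = 0\<close> the condition fails for a vanishing restriction, since \<open>\<epsilon>\<close> and \<open>\<rho>\<close> are positive.
\<close>

definition cond_L3 ::
    "'x::real_normed_vector set \<Rightarrow> 'y::real_normed_vector set \<Rightarrow> ('x \<Rightarrow> 'y \<Rightarrow> real) \<Rightarrow>
     ('x \<Rightarrow> 'x \<Rightarrow> 'y \<Rightarrow> real) \<Rightarrow> real \<Rightarrow> 'x \<Rightarrow> real \<Rightarrow> real \<Rightarrow> real \<Rightarrow> bool" where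
  "cond_L3 X Y a \<Gamma> \<Lambda>P u \<epsilon> \<rho> \<kappa> \<longleftrightarrow>
     \<epsilon> + \<rho> \<le> \<kappa> * beta X Y a \<Gamma> u / ((1 + \<Lambda>P) * trilinear_norm_on X X Y \<Gamma>)"

text \<open>The minimum over \<open>Xh\<close> is read as an infimum, which need not be attained.\<close>

definition cond_QO :: "'x::real_normed_vector set \<Rightarrow> 'x \<Rightarrow> 'x \<Rightarrow> real \<Rightarrow> bool" where
  "cond_QO Xh u uh Cqo \<longleftrightarrow> 0 < Cqo \<and> norm (u - uh) \<le> Cqo * (INF xh\<in>Xh. norm (u - xh))"

text \<open>
  Taking \<open>y = 0\<close> shows that the value is nonnegative for \<open>M = 0\<close>.  For larger \<open>M\<close> it can be
  negative: the integrand is not an absolute value, so the infimum over \<open>yh\<close> may overshoot.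
\<close>

definition intermediate_residual ::
    "'y::real_normed_vector set \<Rightarrow> 'y set \<Rightarrow> ('x \<Rightarrow> 'y \<Rightarrow> real) \<Rightarrow> ('x \<Rightarrow> 'x \<Rightarrow> 'y \<Rightarrow> real) \<Rightarrow>
     ('y \<Rightarrow> real) \<Rightarrow> ('x \<Rightarrow> 'x) \<Rightarrow> ('y \<Rightarrow> 'y) \<Rightarrow> ('x \<Rightarrow> 'x) \<Rightarrow> ('y \<Rightarrow> 'y) \<Rightarrow> 'x \<Rightarrow> real \<Rightarrow> real" where
  "intermediate_residual Y Yh a \<Gamma> F P Q R S vh M =
     (SUP y\<in>{y \<in> Y. norm y \<le> 1}. INF yh\<in>{yh \<in> Yh. norm yh \<le> M}.
        F (y - Q yh) - a (P vh) (y - Q yh) - \<Gamma> (R vh) (R vh) (y - S yh))"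

end

theory Submission
  imports Defs
begin

text \<open>
  Throughout, \<open>e = u - P vh\<close> is the error of the smoothed approximation.  Since \<open>N\<close> is quadratic,
  its Taylor expansion at the root \<open>u\<close> is exact:
  \<open>DN(u; e, y) = \<Gamma>(e, e, y) - N(P vh; y)\<close>.
  The inf-sup constant \<open>\<beta>\<close> of \<open>DN(u)\<close> turns this into
  \<open>\<beta> \<parallel>e\<parallel> \<le> \<parallel>\<Gamma>\<parallel> \<parallel>e\<parallel>\<^sup>2 + sup (- N(P vh; y))\<close>, and the smallness condition on
  \<open>\<epsilon> + \<rho>\<close> bounds the quadratic term by \<open>\<kappa> \<beta> \<parallel>e\<parallel>\<close>, so it can be
  absorbed on the left (\<open>absorbed_error_bound\<close>).  What remains is to compare \<open>- N(P vh; y)\<close> with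
  the intermediate residual.  Insert an arbitrary discrete test function \<open>yh\<close> and use the discrete
  equation for \<open>uh\<close>: all the additional terms are differences \<open>uh - vh\<close> or consistency errors
  controlled by \<open>(1 - P) vh\<close> (\<open>residual_le_consistency\<close>).

  The converse estimate substitutes \<open>F = a(u, \<cdot>) + \<Gamma>(u, u, \<cdot>)\<close> into the intermediate residual and
  bounds the differences \<open>u - P vh\<close> and \<open>u - R vh\<close> by the smoother inequalities
  (\<open>intermediate_residual_zero_le\<close>).

  In both directions the nonlinearity contributes factors \<open>\<parallel>uh\<parallel>\<close>, \<open>\<parallel>vh\<parallel>\<close>.  They are
  bounded by \<open>\<parallel>u\<parallel> + \<epsilon> + \<rho>\<close>, and the smallness condition replaces \<open>\<epsilon> + \<rho>\<close> by
  \<open>\<beta> / ((1 + \<Lambda>P) \<parallel>\<Gamma>\<parallel>)\<close>; this removes \<open>\<epsilon>\<close> and \<open>\<rho>\<close> from the constants wherever that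
  condition is assumed.
\<close>

section \<open>Linear and multilinear maps on subspaces\<close>

lemma linear_map_onD:
  assumes "linear_map_on V f" "subspace V"
  shows linear_map_on_zero: "f 0 = 0"
    and linear_map_on_scale: "x \<in> V \<Longrightarrow> f (c *\<^sub>R x) = c *\<^sub>R f x"
    and linear_map_on_minus: "x \<in> V \<Longrightarrow> f (- x) = - f x"
    and linear_map_on_diff: "x \<in> V \<Longrightarrow> y \<in> V \<Longrightarrow> f (x - y) = f x - f y"
proof -
  have add: "f (x + y) = f x + f y" if "x \<in> V" "y \<in> V" for x y
    using assms that unfolding linear_map_on_def by blast
  show scale: "f (c *\<^sub>R x) = c *\<^sub>R f x" if "x \<in> V" for c x
    using assms that unfolding linear_map_on_def by blast
  show "f 0 = 0"
    using scale[of 0 0] subspace_0[OF assms(2)] by simp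
  show minus: "f (- x) = - f x" if "x \<in> V" for x
    using scale[of x "-1"] that by simp
  show "f (x - y) = f x - f y" if "x \<in> V" "y \<in> V" for x y
    using add[of x "- y"] minus[of y] that subspace_neg[OF assms(2)] by simp
qed

lemma zero_in_unit_ball_on: "subspace V \<Longrightarrow> 0 \<in> unit_ball_on V"
  by (simp add: unit_ball_on_def subspace_0)

lemma normalized_in_unit_ball_on:
  "subspace V \<Longrightarrow> x \<in> V \<Longrightarrow> inverse (norm x) *\<^sub>R x \<in> unit_ball_on V"
  by (cases "x = 0") (simp_all add: unit_ball_on_def subspace_scale subspace_0)

lemma linear_norm_on_bound:
  assumes V: "subspace V" and f: "bounded_linear_map_on V f"
  shows linear_norm_on_nonneg: "0 \<le> linear_norm_on V f"
    and norm_le_linear_norm_on: "x \<in> V \<Longrightarrow> norm (f x) \<le> linear_norm_on V f * norm x"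
proof -
  have lin: "linear_map_on V f" using f by (simp add: bounded_linear_map_on_def)
  obtain K where K: "norm (f x) \<le> K * norm x" if "x \<in> V" for x
    using f unfolding bounded_linear_map_on_def by blast
  have "bdd_above ((\<lambda>x. norm (f x)) ` unit_ball_on V)"
  proof (rule bdd_aboveI2)
    fix x assume x: "x \<in> unit_ball_on V"
    have "norm (f x) \<le> K * norm x" using K x by (simp add: unit_ball_on_def)
    also have "\<dots> \<le> \<bar>K\<bar> * 1"
      using x by (intro mult_mono) (auto simp: unit_ball_on_def)
    finally show "norm (f x) \<le> \<bar>K\<bar>" by simp
  qed
  then have le: "norm (f x) \<le> linear_norm_on V f" if "x \<in> unit_ball_on V" for x
    unfolding linear_norm_on_def using that by (intro cSUP_upper)
  show "0 \<le> linear_norm_on V f"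
    using le[OF zero_in_unit_ball_on[OF V]] norm_ge_zero order_trans by blast
  show "norm (f x) \<le> linear_norm_on V f * norm x" if x: "x \<in> V"
  proof (cases "x = 0")
    case True
    then show ?thesis using linear_map_on_zero[OF lin V] by simp
  next
    case False
    then show ?thesis
      using le[OF normalized_in_unit_ball_on[OF V x]] linear_map_on_scale[OF lin V x]
      by (simp add: field_simps)
  qed
qed

lemma bilinear_norm_on_bound:
  assumes V: "subspace V" and W: "subspace W" and b: "bounded_bilinear_form_on V W b"
  shows bilinear_norm_on_nonneg: "0 \<le> bilinear_norm_on V W b"
    and abs_le_bilinear_norm_on:
      "x \<in> V \<Longrightarrow> y \<in> W \<Longrightarrow> \<bar>b x y\<bar> \<le> bilinear_norm_on V W b * norm x * norm y"
proof -
  have lin1: "linear_map_on V (\<lambda>x. b x y)" if "y \<in> W" for y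
    using b that by (simp add: bounded_bilinear_form_on_def)
  have lin2: "linear_map_on W (b x)" if "x \<in> V" for x
    using b that by (simp add: bounded_bilinear_form_on_def)
  obtain K where K: "\<bar>b x y\<bar> \<le> K * norm x * norm y" if "x \<in> V" "y \<in> W" for x y
    using b unfolding bounded_bilinear_form_on_def by blast
  have bdd: "bdd_above ((\<lambda>(x, y). \<bar>b x y\<bar>) ` (unit_ball_on V \<times> unit_ball_on W))"
  proof (rule bdd_aboveI2, clarify)
    fix x y assume x: "x \<in> unit_ball_on V" and y: "y \<in> unit_ball_on W"
    have "\<bar>b x y\<bar> \<le> K * norm x * norm y" using K x y by (simp add: unit_ball_on_def)
    also have "\<dots> \<le> \<bar>K\<bar> * 1 * 1"
      using x y by (intro mult_mono) (auto simp: unit_ball_on_def)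
    finally show "\<bar>b x y\<bar> \<le> \<bar>K\<bar>" by simp
  qed
  have le: "\<bar>b x y\<bar> \<le> bilinear_norm_on V W b"
    if "x \<in> unit_ball_on V" "y \<in> unit_ball_on W" for x y
    unfolding bilinear_norm_on_def using that cSUP_upper[OF _ bdd, of "(x, y)"] by simp
  show "0 \<le> bilinear_norm_on V W b"
    using le[OF zero_in_unit_ball_on[OF V] zero_in_unit_ball_on[OF W]] abs_ge_zero order_trans
    by blast
  show "\<bar>b x y\<bar> \<le> bilinear_norm_on V W b * norm x * norm y" if x: "x \<in> V" and y: "y \<in> W"
  proof (cases "x = 0 \<or> y = 0")
    case True
    then show ?thesis
      using linear_map_on_zero[OF lin1[OF y] V] linear_map_on_zero[OF lin2[OF x] W] by auto
  next
    case False
    let ?x = "inverse (norm x) *\<^sub>R x" and ?y = "inverse (norm y) *\<^sub>R y"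
    have y': "?y \<in> W" using y W by (simp add: subspace_scale)
    have "b ?x ?y = inverse (norm x) * (inverse (norm y) * b x y)"
      using linear_map_on_scale[OF lin1[OF y'] V x] linear_map_on_scale[OF lin2[OF x] W y] by simp
    then have "inverse (norm x) * (inverse (norm y) * \<bar>b x y\<bar>) \<le> bilinear_norm_on V W b"
      using le[OF normalized_in_unit_ball_on[OF V x] normalized_in_unit_ball_on[OF W y]]
      by (simp add: abs_mult)
    then show ?thesis using False by (simp add: field_simps)
  qed
qed

lemma trilinear_norm_on_bound:
  assumes U: "subspace U" and V: "subspace V" and W: "subspace W"
    and g: "bounded_trilinear_form_on U V W g"
  shows trilinear_norm_on_nonneg: "0 \<le> trilinear_norm_on U V W g"
    and abs_le_trilinear_norm_on: "x \<in> U \<Longrightarrow> y \<in> V \<Longrightarrow> z \<in> W \<Longrightarrow>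
      \<bar>g x y z\<bar> \<le> trilinear_norm_on U V W g * norm x * norm y * norm z"
proof -
  have lin1: "linear_map_on U (\<lambda>x. g x y z)" if "y \<in> V" "z \<in> W" for y z
    using g that by (simp add: bounded_trilinear_form_on_def)
  have lin2: "linear_map_on V (\<lambda>y. g x y z)" if "x \<in> U" "z \<in> W" for x z
    using g that by (simp add: bounded_trilinear_form_on_def)
  have lin3: "linear_map_on W (g x y)" if "x \<in> U" "y \<in> V" for x y
    using g that by (simp add: bounded_trilinear_form_on_def)
  obtain K where K: "\<bar>g x y z\<bar> \<le> K * norm x * norm y * norm z"
    if "x \<in> U" "y \<in> V" "z \<in> W" for x y z
    using g unfolding bounded_trilinear_form_on_def by blast
  have bdd: "bdd_above ((\<lambda>(x, y, z). \<bar>g x y z\<bar>) `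
      (unit_ball_on U \<times> unit_ball_on V \<times> unit_ball_on W))"
  proof (rule bdd_aboveI2, clarify)
    fix x y z
    assume xyz: "x \<in> unit_ball_on U" "y \<in> unit_ball_on V" "z \<in> unit_ball_on W"
    have "\<bar>g x y z\<bar> \<le> K * norm x * norm y * norm z" using K xyz by (simp add: unit_ball_on_def)
    also have "\<dots> \<le> \<bar>K\<bar> * 1 * 1 * 1"
      using xyz by (intro mult_mono) (auto simp: unit_ball_on_def)
    finally show "\<bar>g x y z\<bar> \<le> \<bar>K\<bar>" by simp
  qed
  have le: "\<bar>g x y z\<bar> \<le> trilinear_norm_on U V W g"
    if "x \<in> unit_ball_on U" "y \<in> unit_ball_on V" "z \<in> unit_ball_on W" for x y z
    unfolding trilinear_norm_on_def using that cSUP_upper[OF _ bdd, of "(x, y, z)"] by simp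
  show "0 \<le> trilinear_norm_on U V W g"
    using le[OF zero_in_unit_ball_on[OF U] zero_in_unit_ball_on[OF V] zero_in_unit_ball_on[OF W]]
      abs_ge_zero order_trans by blast
  show "\<bar>g x y z\<bar> \<le> trilinear_norm_on U V W g * norm x * norm y * norm z"
    if x: "x \<in> U" and y: "y \<in> V" and z: "z \<in> W"
  proof (cases "x = 0 \<or> y = 0 \<or> z = 0")
    case True
    then show ?thesis
      using linear_map_on_zero[OF lin1[OF y z] U] linear_map_on_zero[OF lin2[OF x z] V]
        linear_map_on_zero[OF lin3[OF x y] W] by auto
  next
    case False
    let ?x = "inverse (norm x) *\<^sub>R x" and ?y = "inverse (norm y) *\<^sub>R y"
      and ?z = "inverse (norm z) *\<^sub>R z"
    have y': "?y \<in> V" and z': "?z \<in> W" using y z V W by (simp_all add: subspace_scale)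
    have "g ?x ?y ?z = inverse (norm x) * (inverse (norm y) * (inverse (norm z) * g x y z))"
      using linear_map_on_scale[OF lin1[OF y' z'] U x] linear_map_on_scale[OF lin2[OF x z'] V y]
        linear_map_on_scale[OF lin3[OF x y] W z] by simp
    then have "inverse (norm x) * (inverse (norm y) * (inverse (norm z) * \<bar>g x y z\<bar>))
        \<le> trilinear_norm_on U V W g"
      using le[OF normalized_in_unit_ball_on[OF U x] normalized_in_unit_ball_on[OF V y]
          normalized_in_unit_ball_on[OF W z]]
      by (simp add: abs_mult)
    then show ?thesis using False by (simp add: field_simps)
  qed
qed

lemma bounded_trilinear_form_on_subset:
  assumes "bounded_trilinear_form_on U V W g" "U' \<subseteq> U" "V' \<subseteq> V" "W' \<subseteq> W"
  shows "bounded_trilinear_form_on U' V' W' g"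
  using assms unfolding bounded_trilinear_form_on_def linear_map_on_def by (meson subsetD)

text \<open>
  Telescoping \<open>g x x w - g z z w = g (x - z) x w + g z (x - z) w\<close>.  The arguments keep their
  places because \<open>g\<close> may be unsymmetric.
\<close>

lemma trilinear_diagonal_diff_bound:
  assumes V: "subspace V" and W: "subspace W" and g: "bounded_trilinear_form_on V V W g"
    and x: "x \<in> V" and z: "z \<in> V" and w: "w \<in> W"
  shows "\<bar>g x x w - g z z w\<bar>
    \<le> trilinear_norm_on V V W g * norm (x - z) * (norm x + norm z) * norm w"
proof -
  have d: "x - z \<in> V" using V x z by (simp add: subspace_diff)
  have "g (x - z) x w = g x x w - g z x w"
    using g x z w V by (intro linear_map_on_diff[of V "\<lambda>x'. g x' x w"])
      (auto simp: bounded_trilinear_form_on_def)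
  moreover have "g z (x - z) w = g z x w - g z z w"
    using g x z w V by (intro linear_map_on_diff[of V "\<lambda>x'. g z x' w"])
      (auto simp: bounded_trilinear_form_on_def)
  ultimately have "g x x w - g z z w = g (x - z) x w + g z (x - z) w" by simp
  moreover note abs_le_trilinear_norm_on[OF V V W g d x w] abs_le_trilinear_norm_on[OF V V W g z d w]
  ultimately show ?thesis by (simp add: algebra_simps)
qed

text \<open>
  The hypothesis \<open>0 < real_of_ereal (inf_sup V W b)\<close> rules out the infinite values, which
  \<^const>\<open>real_of_ereal\<close> sends to \<open>0\<close>.
\<close>

lemma inf_sup_stability:
  assumes V: "subspace V" and lin: "\<And>y. y \<in> W \<Longrightarrow> linear_map_on V (\<lambda>x. b x y)"
    and pos: "0 < real_of_ereal (inf_sup V W b)"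
    and x: "x \<in> V" "x \<noteq> 0"
    and T: "\<And>y. y \<in> W \<Longrightarrow> norm y = 1 \<Longrightarrow> b x y \<le> T"
  shows "real_of_ereal (inf_sup V W b) * norm x \<le> T"
proof -
  let ?x = "inverse (norm x) *\<^sub>R x"
  have real: "ereal (real_of_ereal (inf_sup V W b)) = inf_sup V W b"
    using pos by (cases "inf_sup V W b") auto
  have x': "?x \<in> unit_sphere_on V"
    using x V by (simp add: unit_sphere_on_def subspace_scale)
  have "inf_sup V W b \<le> (SUP y\<in>unit_sphere_on W. ereal (b ?x y))"
    unfolding inf_sup_def using x' by (rule INF_lower)
  also have "\<dots> \<le> ereal (T / norm x)"
  proof (rule SUP_least)
    fix y assume y: "y \<in> unit_sphere_on W"
    then have "b ?x y = inverse (norm x) * b x y"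
      using linear_map_on_scale[OF lin V x(1)] by (simp add: unit_sphere_on_def)
    also have "\<dots> \<le> inverse (norm x) * T"
      using T y by (intro mult_left_mono) (auto simp: unit_sphere_on_def)
    finally show "ereal (b ?x y) \<le> ereal (T / norm x)" by (simp add: field_simps)
  qed
  finally have "real_of_ereal (inf_sup V W b) \<le> T / norm x"
    using real by (metis ereal_less_eq(3))
  then show ?thesis using x by (simp add: field_simps)
qed

section \<open>The intermediate residual\<close>

context semilinear_scheme
begin

lemma F_bounded: "bounded_linear_map_on Y F"
  using F_dual by (simp add: dual_space_def)

lemma \<Gamma>_restriction_bounded: "bounded_trilinear_form_on X X Y \<Gamma>"
  using bounded_trilinear_form_on_subset[OF \<Gamma>_bounded] by simp

lemma \<Gamma>_add:
  "\<Gamma> (x + x') y z = \<Gamma> x y z + \<Gamma> x' y z"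
  "\<Gamma> x (y + y') z = \<Gamma> x y z + \<Gamma> x y' z"
  "\<Gamma> x y (w + w') = \<Gamma> x y w + \<Gamma> x y w'"
  using \<Gamma>_bounded unfolding bounded_trilinear_form_on_def linear_map_on_def by simp_all

lemma \<Gamma>_diff:
  "\<Gamma> (x - x') y z = \<Gamma> x y z - \<Gamma> x' y z"
  "\<Gamma> x (y - y') z = \<Gamma> x y z - \<Gamma> x y' z"
  "\<Gamma> x y (w - w') = \<Gamma> x y w - \<Gamma> x y w'"
  using \<Gamma>_add(1)[of "x - x'" x' y z] \<Gamma>_add(2)[of x "y - y'" y' z]
    \<Gamma>_add(3)[of x y "w - w'" w']
  unfolding diff_add_cancel by linarith+

lemma linear_a:
  shows linear_a1: "y \<in> Y \<Longrightarrow> linear_map_on X (\<lambda>x. a x y)"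
    and linear_a2: "x \<in> X \<Longrightarrow> linear_map_on Y (a x)"
  using a_bounded by (simp_all add: bounded_bilinear_form_on_def)

lemma linear_ah:
  shows linear_ah1: "yh \<in> Yh \<Longrightarrow> linear_map_on Xh (\<lambda>x. ah x yh)"
    and linear_ah2: "xh \<in> Xh \<Longrightarrow> linear_map_on Yh (ah xh)"
  using ah_bounded by (simp_all add: bounded_bilinear_form_on_def)

lemma linear_Q_R_S_F:
  shows linear_Q: "linear_map_on Yh Q" and linear_R: "linear_map_on Xh R"
    and linear_S: "linear_map_on Yh S" and linear_F: "linear_map_on Y F"
  using Q_smoother R_smoother S_smoother F_bounded by (simp_all add: bounded_linear_map_on_def)

lemma P_in_X: "xh \<in> Xh \<Longrightarrow> P xh \<in> X" and Q_in_Y: "yh \<in> Yh \<Longrightarrow> Q yh \<in> Y"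
  using P_smoother Q_smoother by auto

definition tested_residual :: "'x \<Rightarrow> 'y \<Rightarrow> 'y \<Rightarrow> real" where
  "tested_residual vh y yh =
     F (y - Q yh) - a (P vh) (y - Q yh) - \<Gamma> (R vh) (R vh) (y - S yh)"

abbreviation \<rho>res :: "'x \<Rightarrow> real \<Rightarrow> real" where
  "\<rho>res \<equiv> intermediate_residual Y Yh a \<Gamma> F P Q R S"

lemma \<rho>res_eq:
  "\<rho>res vh M =
    (SUP y\<in>{y \<in> Y. norm y \<le> 1}. INF yh\<in>{yh \<in> Yh. norm yh \<le> M}. tested_residual vh y yh)"
  by (simp add: intermediate_residual_def tested_residual_def)

text \<open>
  Suprema and infima of unbounded sets of reals are unspecified; this bound makes those in the
  intermediate residual meaningful.
\<close>

lemma tested_residual_bounded: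
  assumes vh: "vh \<in> Xh" and M: "0 \<le> M"
  obtains B where "\<And>y yh. y \<in> Y \<Longrightarrow> norm y \<le> 1 \<Longrightarrow> yh \<in> Yh \<Longrightarrow> norm yh \<le> M \<Longrightarrow>
    \<bar>tested_residual vh y yh\<bar> \<le> B"
proof -
  let ?nF = "linear_norm_on Y F" and ?na = "bilinear_norm_on X Y a"
    and ?ng = "trilinear_norm_on UNIV UNIV UNIV \<Gamma>"
    and ?nQ = "linear_norm_on Yh Q" and ?nS = "linear_norm_on Yh S"
  let ?B = "?nF * (1 + ?nQ * M) + ?na * norm (P vh) * (1 + ?nQ * M)
     + ?ng * norm (R vh) * norm (R vh) * (1 + ?nS * M)"
  have nonneg: "0 \<le> ?nF" "0 \<le> ?na" "0 \<le> ?ng" "0 \<le> ?nQ" "0 \<le> ?nS"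
    using linear_norm_on_nonneg[OF subspaces(3) F_bounded]
      bilinear_norm_on_nonneg[OF subspaces(1,3) a_bounded]
      trilinear_norm_on_nonneg[OF subspace_UNIV subspace_UNIV subspace_UNIV \<Gamma>_bounded]
      linear_norm_on_nonneg[OF subspaces(4) Q_smoother(1)]
      linear_norm_on_nonneg[OF subspaces(4) S_smoother]
    by auto
  have "\<bar>tested_residual vh y yh\<bar> \<le> ?B"
    if y: "y \<in> Y" "norm y \<le> 1" and yh: "yh \<in> Yh" "norm yh \<le> M" for y yh
  proof -
    have "norm (Q yh) \<le> ?nQ * norm yh"
      by (rule norm_le_linear_norm_on[OF subspaces(4) Q_smoother(1) yh(1)])
    also have "\<dots> \<le> ?nQ * M" using yh nonneg by (intro mult_left_mono)
    finally have Q: "norm (y - Q yh) \<le> 1 + ?nQ * M"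
      using y norm_triangle_ineq4[of y "Q yh"] by linarith
    have "norm (S yh) \<le> ?nS * norm yh"
      by (rule norm_le_linear_norm_on[OF subspaces(4) S_smoother yh(1)])
    also have "\<dots> \<le> ?nS * M" using yh nonneg by (intro mult_left_mono)
    finally have S: "norm (y - S yh) \<le> 1 + ?nS * M"
      using y norm_triangle_ineq4[of y "S yh"] by linarith
    have z: "y - Q yh \<in> Y" using y yh Q_in_Y subspaces(3) by (simp add: subspace_diff)
    have "\<bar>F (y - Q yh)\<bar> \<le> ?nF * norm (y - Q yh)"
      using norm_le_linear_norm_on[OF subspaces(3) F_bounded z] by simp
    also have "\<dots> \<le> ?nF * (1 + ?nQ * M)" using Q nonneg by (intro mult_left_mono)
    finally have 1: "\<bar>F (y - Q yh)\<bar> \<le> ?nF * (1 + ?nQ * M)" .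
    have "\<bar>a (P vh) (y - Q yh)\<bar> \<le> ?na * norm (P vh) * norm (y - Q yh)"
      by (rule abs_le_bilinear_norm_on[OF subspaces(1,3) a_bounded P_in_X[OF vh] z])
    also have "\<dots> \<le> ?na * norm (P vh) * (1 + ?nQ * M)"
      using Q nonneg by (intro mult_left_mono) auto
    finally have 2: "\<bar>a (P vh) (y - Q yh)\<bar> \<le> ?na * norm (P vh) * (1 + ?nQ * M)" .
    have "\<bar>\<Gamma> (R vh) (R vh) (y - S yh)\<bar> \<le> ?ng * norm (R vh) * norm (R vh) * norm (y - S yh)"
      by (rule abs_le_trilinear_norm_on[OF subspace_UNIV subspace_UNIV subspace_UNIV \<Gamma>_bounded])
        auto
    also have "\<dots> \<le> ?ng * norm (R vh) * norm (R vh) * (1 + ?nS * M)"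
      using S nonneg by (intro mult_left_mono) auto
    finally show ?thesis using 1 2 unfolding tested_residual_def by linarith
  qed
  then show thesis using that by blast
qed

lemma tested_residual_bdd_below:
  assumes "vh \<in> Xh" "0 \<le> M" "y \<in> Y" "norm y \<le> 1"
  shows "bdd_below (tested_residual vh y ` {yh \<in> Yh. norm yh \<le> M})"
proof -
  obtain B where "\<And>yh. yh \<in> Yh \<Longrightarrow> norm yh \<le> M \<Longrightarrow> \<bar>tested_residual vh y yh\<bar> \<le> B"
    using tested_residual_bounded[OF assms(1,2)] assms(3,4) by metis
  then have "- B \<le> tested_residual vh y yh" if "yh \<in> Yh" "norm yh \<le> M" for yh
    using that by (fastforce simp: abs_le_iff)
  then show ?thesis by (intro bdd_belowI2[of _ "- B"]) auto
qed

lemma inner_infimum_bdd_above: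
  assumes "vh \<in> Xh" "0 \<le> M"
  shows "bdd_above ((\<lambda>y. INF yh\<in>{yh \<in> Yh. norm yh \<le> M}. tested_residual vh y yh) `
    {y \<in> Y. norm y \<le> 1})"
proof -
  obtain B where B: "\<And>y yh. y \<in> Y \<Longrightarrow> norm y \<le> 1 \<Longrightarrow> yh \<in> Yh \<Longrightarrow> norm yh \<le> M \<Longrightarrow>
      \<bar>tested_residual vh y yh\<bar> \<le> B"
    using tested_residual_bounded[OF assms] by metis
  have "(INF yh\<in>{yh \<in> Yh. norm yh \<le> M}. tested_residual vh y yh) \<le> B"
    if y: "y \<in> Y" "norm y \<le> 1" for y
  proof (rule cINF_lower2[OF tested_residual_bdd_below[OF assms y]])
    show "0 \<in> {yh \<in> Yh. norm yh \<le> M}" using assms subspaces by (simp add: subspace_0)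
    show "tested_residual vh y 0 \<le> B"
      using B[OF y, of 0] assms subspaces by (simp add: subspace_0)
  qed
  then show ?thesis by (intro bdd_aboveI2[of _ _ B]) auto
qed

text \<open>
  An upper bound that holds against every discrete test function passes to the infimum, hence to
  the intermediate residual; no minimising \<open>yh\<close> has to exist.
\<close>

lemma le_intermediate_residual:
  assumes "vh \<in> Xh" "0 \<le> M" and y: "y \<in> Y" "norm y \<le> 1"
    and T: "\<And>yh. yh \<in> Yh \<Longrightarrow> norm yh \<le> M \<Longrightarrow> T \<le> tested_residual vh y yh"
  shows "T \<le> \<rho>res vh M"
proof -
  have "T \<le> (INF yh\<in>{yh \<in> Yh. norm yh \<le> M}. tested_residual vh y yh)"
    using assms subspace_0[OF subspaces(4)] by (intro cINF_greatest) auto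
  also have "\<dots> \<le> \<rho>res vh M"
    unfolding \<rho>res_eq using y by (intro cSUP_upper inner_infimum_bdd_above assms) auto
  finally show ?thesis .
qed

lemma intermediate_residual_antimono:
  assumes vh: "vh \<in> Xh" and M: "0 \<le> M" "M \<le> M'"
  shows "\<rho>res vh M' \<le> \<rho>res vh M"
proof -
  have "(INF yh\<in>{yh \<in> Yh. norm yh \<le> M'}. tested_residual vh y yh)
      \<le> (INF yh\<in>{yh \<in> Yh. norm yh \<le> M}. tested_residual vh y yh)"
    if "y \<in> Y" "norm y \<le> 1" for y
    using that M subspace_0[OF subspaces(4)] tested_residual_bdd_below[OF vh, of M' y]
    by (intro cINF_superset_mono) auto
  moreover have "{y \<in> Y. norm y \<le> 1} \<noteq> {}"
    using subspace_0[OF subspaces(3)] by auto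
  ultimately show ?thesis
    unfolding \<rho>res_eq using inner_infimum_bdd_above[OF vh M(1)] by (intro cSUP_mono) auto
qed

section \<open>Stability of the smoothers\<close>

text \<open>
  The smoother inequalities with \<open>x = 0\<close> bound the operator norms of \<open>P\<close> and \<open>R\<close>, which are not
  among the quantities that the constants may depend on.
\<close>

lemma smoother_norm_bounds:
  assumes "xh \<in> Xh"
  shows norm_P_le: "norm (P xh) \<le> (1 + \<Lambda>P) * norm xh"
    and norm_R_le: "norm (R xh) \<le> (1 + \<Lambda>R) * norm xh"
  using SP[OF assms subspace_0[OF subspaces(1)]] SR[OF assms subspace_0[OF subspaces(1)]]
    norm_triangle_ineq3[of "P xh" xh] norm_triangle_ineq3[of "R xh" xh]
  by (auto simp: algebra_simps norm_minus_commute)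

lemma smoothed_error_bounds:
  assumes "xh \<in> Xh" "x \<in> X"
  shows smoothed_error_P: "norm (x - P xh) \<le> (1 + \<Lambda>P) * norm (x - xh)"
    and smoothed_error_R: "norm (x - R xh) \<le> (1 + \<Lambda>R) * norm (x - xh)"
  using SP[OF assms] SR[OF assms]
    norm_triangle_ineq[of "x - xh" "xh - P xh"] norm_triangle_ineq[of "x - xh" "xh - R xh"]
  by (auto simp: algebra_simps)

text \<open>
  \<open>P xh\<close> is itself an admissible \<open>x\<close> in the smoother inequality for \<open>R\<close>; this is why the error
  estimator needs no term \<open>(1 - R) vh\<close>.
\<close>

lemma norm_R_minus_P_le:
  assumes "xh \<in> Xh"
  shows "norm (R xh - P xh) \<le> (1 + \<Lambda>R) * norm (xh - P xh)"
  using smoothed_error_R[OF assms P_in_X[OF assms]] by (simp add: norm_minus_commute)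

section \<open>Reliability\<close>

text \<open>
  The exact Taylor expansion of the residual at \<open>u\<close> meets inf-sup stability.  By the smallness
  assumption \<open>small\<close> the quadratic remainder costs only the fraction \<open>\<kappa>\<close> of \<open>\<beta> \<parallel>u - x\<parallel>\<close>.
\<close>

lemma absorbed_error_bound:
  assumes u: "u \<in> X" and root: "\<And>y. y \<in> Y \<Longrightarrow> a u y + \<Gamma> u u y = F y"
    and x: "x \<in> X"
    and pos: "0 < beta X Y a \<Gamma> u"
    and small: "trilinear_norm_on X X Y \<Gamma> * norm (u - x) \<le> \<kappa> * beta X Y a \<Gamma> u"
    and T: "\<And>y. y \<in> Y \<Longrightarrow> norm y = 1 \<Longrightarrow> F y - a x y - \<Gamma> x x y \<le> T"
    and T_nonneg: "0 \<le> T"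
  shows "(1 - \<kappa>) * beta X Y a \<Gamma> u * norm (u - x) \<le> T"
proof (cases "u = x")
  case True
  then show ?thesis using T_nonneg by simp
next
  case False
  let ?b = "\<lambda>x y. a x y + \<Gamma> u x y + \<Gamma> x u y"
  let ?\<beta> = "beta X Y a \<Gamma> u"
  let ?g = "trilinear_norm_on X X Y \<Gamma>"
  have e: "u - x \<in> X" using u x subspaces(1) by (simp add: subspace_diff)
  have "real_of_ereal (inf_sup X Y ?b) * norm (u - x) \<le> T + \<kappa> * ?\<beta> * norm (u - x)"
  proof (rule inf_sup_stability)
    show "linear_map_on X (\<lambda>x. ?b x y)" if "y \<in> Y" for y
      using \<Gamma>_bounded linear_a1[OF that]
      by (auto simp: linear_map_on_def bounded_trilinear_form_on_def algebra_simps)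
    show "0 < real_of_ereal (inf_sup X Y ?b)" using pos by (simp add: beta_def)
    fix y assume y: "y \<in> Y" "norm y = 1"
    have "a (u - x) y = a u y - a x y"
      using linear_map_on_diff[OF linear_a1[OF y(1)] subspaces(1) u x] .
    then have "?b (u - x) y = \<Gamma> (u - x) (u - x) y + (F y - a x y - \<Gamma> x x y)"
      using root[OF y(1)] by (simp add: \<Gamma>_diff)
    moreover have "\<bar>\<Gamma> (u - x) (u - x) y\<bar> \<le> ?g * norm (u - x) * norm (u - x)"
      using abs_le_trilinear_norm_on[OF subspaces(1,1,3) \<Gamma>_restriction_bounded e e y(1)] y(2)
      by simp
    moreover have "?g * norm (u - x) * norm (u - x) \<le> \<kappa> * ?\<beta> * norm (u - x)"
      using small by (intro mult_right_mono) auto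
    ultimately show "?b (u - x) y \<le> T + \<kappa> * ?\<beta> * norm (u - x)"
      using T[OF y] by linarith
  qed (use subspaces e False in auto)
  then show ?thesis by (simp add: beta_def algebra_simps)
qed

text \<open>
  The discrete equation \<open>F (Q yh) = ah uh yh + \<Gamma> (R uh) (R uh) (S yh)\<close> converts the part of the
  residual tested with \<open>Q yh\<close> into three differences: \<open>ah (uh - vh) yh\<close>, the consistency error of
  \<open>ah\<close>, and a difference of diagonal values of \<open>\<Gamma>\<close>.  A fourth one, between \<open>R vh\<close> and
  \<open>P vh\<close>, comes from replacing \<open>\<Gamma> (R vh) (R vh) y\<close>.
\<close>

lemma residual_le_consistency:
  assumes H: "cond_H Xh Yh a ah P Q \<Lambda>C"
    and uh: "uh \<in> Xh" "\<And>yh. yh \<in> Yh \<Longrightarrow> ah uh yh + \<Gamma> (R uh) (R uh) (S yh) = F (Q yh)"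
    and vh: "vh \<in> Xh"
    and r: "norm uh \<le> r" "norm vh \<le> r"
    and y: "y \<in> Y" "norm y = 1" and yh: "yh \<in> Yh" "norm yh \<le> M"
  shows "F y - a (P vh) y - \<Gamma> (P vh) (P vh) y \<le> tested_residual vh y yh
    + (bilinear_norm_on Xh Yh ah
        + trilinear_norm_on UNIV UNIV UNIV \<Gamma> * linear_norm_on Yh S * (2 * (1 + \<Lambda>R)\<^sup>2 * r))
      * (M * norm (uh - vh))
    + \<Lambda>C * (M * norm (vh - P vh))
    + trilinear_norm_on UNIV UNIV UNIV \<Gamma> * (1 + \<Lambda>R) * ((2 + \<Lambda>R + \<Lambda>P) * r) * norm (vh - P vh)"
proof -
  let ?nah = "bilinear_norm_on Xh Yh ah" and ?g = "trilinear_norm_on UNIV UNIV UNIV \<Gamma>"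
    and ?s = "linear_norm_on Yh S"
  have g0: "0 \<le> ?g"
    by (rule trilinear_norm_on_nonneg[OF subspace_UNIV subspace_UNIV subspace_UNIV \<Gamma>_bounded])
  have s0: "0 \<le> ?s" by (rule linear_norm_on_nonneg[OF subspaces(4) S_smoother])
  have nah0: "0 \<le> ?nah" by (rule bilinear_norm_on_nonneg[OF subspaces(2,4) ah_bounded])
  have r0: "0 \<le> r" using r(1) norm_ge_zero order_trans by blast
  have M0: "0 \<le> M" using yh(2) norm_ge_zero order_trans by blast
  have \<Lambda>C0: "0 \<le> \<Lambda>C" using H by (simp add: cond_H_def)
  have d: "uh - vh \<in> Xh" using uh vh subspaces(2) by (simp add: subspace_diff)
  have Qy: "Q yh \<in> Y" by (rule Q_in_Y[OF yh(1)])
  have Pv: "P vh \<in> X" by (rule P_in_X[OF vh])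
  have R_bound: "norm (R xh) \<le> (1 + \<Lambda>R) * r" if "xh \<in> Xh" "norm xh \<le> r" for xh
    by (rule order_trans[OF norm_R_le[OF that(1)] mult_left_mono[OF that(2)]])
      (use \<Lambda>_nonneg in simp)

  have 1: "ah uh yh - ah vh yh \<le> ?nah * (M * norm (uh - vh))"
  proof -
    have "ah uh yh - ah vh yh = ah (uh - vh) yh"
      using linear_map_on_diff[OF linear_ah1[OF yh(1)] subspaces(2) uh(1) vh] by simp
    also have "\<dots> \<le> ?nah * norm (uh - vh) * norm yh"
      using abs_le_bilinear_norm_on[OF subspaces(2,4) ah_bounded d yh(1)] by simp
    also have "\<dots> \<le> ?nah * norm (uh - vh) * M"
      using yh(2) nah0 by (intro mult_left_mono) auto
    finally show ?thesis by (simp add: mult_ac)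
  qed
  \<comment> \<open>The consistency condition is one-sided; testing it with \<open>- yh\<close> gives the sign needed here.\<close>
  have 2: "ah vh yh - a (P vh) (Q yh) \<le> \<Lambda>C * (M * norm (vh - P vh))"
  proof -
    have "- yh \<in> Yh" using yh(1) subspaces(4) by (simp add: subspace_neg)
    then have "a (P vh) (Q (- yh)) - ah vh (- yh) \<le> \<Lambda>C * norm (vh - P vh) * norm (- yh)"
      using H vh unfolding cond_H_def by blast
    then have "ah vh yh - a (P vh) (Q yh) \<le> \<Lambda>C * norm (vh - P vh) * norm yh"
      using linear_map_on_minus[OF linear_Q subspaces(4) yh(1)]
        linear_map_on_minus[OF linear_a2[OF Pv] subspaces(3) Qy]
        linear_map_on_minus[OF linear_ah2[OF vh] subspaces(4) yh(1)] by simp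
    also have "\<dots> \<le> \<Lambda>C * norm (vh - P vh) * M"
      using yh(2) \<Lambda>C0 by (intro mult_left_mono) auto
    finally show ?thesis by (simp add: mult_ac)
  qed
  have 3: "\<Gamma> (R uh) (R uh) (S yh) - \<Gamma> (R vh) (R vh) (S yh)
      \<le> ?g * ?s * (2 * (1 + \<Lambda>R)\<^sup>2 * r) * (M * norm (uh - vh))"
  proof -
    have Rd: "norm (R uh - R vh) \<le> (1 + \<Lambda>R) * norm (uh - vh)"
      using norm_R_le[OF d] linear_map_on_diff[OF linear_R subspaces(2) uh(1) vh] by simp
    have Rs: "norm (R uh) + norm (R vh) \<le> 2 * ((1 + \<Lambda>R) * r)"
      using R_bound[OF uh(1) r(1)] R_bound[OF vh r(2)] by simp
    have Sy: "norm (S yh) \<le> ?s * M"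
      using norm_le_linear_norm_on[OF subspaces(4) S_smoother yh(1)]
        mult_left_mono[OF yh(2) s0] by linarith
    have "\<Gamma> (R uh) (R uh) (S yh) - \<Gamma> (R vh) (R vh) (S yh)
        \<le> ?g * norm (R uh - R vh) * (norm (R uh) + norm (R vh)) * norm (S yh)"
      using trilinear_diagonal_diff_bound[OF subspace_UNIV subspace_UNIV \<Gamma>_bounded,
          of "R uh" "R vh" "S yh"] by simp
    also have "\<dots> \<le> ?g * ((1 + \<Lambda>R) * norm (uh - vh)) * (2 * ((1 + \<Lambda>R) * r)) * (?s * M)"
      using Rd Rs Sy g0 s0 r0 M0 \<Lambda>_nonneg by (intro mult_mono) auto
    finally show ?thesis by (simp add: power2_eq_square mult_ac)
  qed
  have 4: "\<Gamma> (R vh) (R vh) y - \<Gamma> (P vh) (P vh) y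
      \<le> ?g * (1 + \<Lambda>R) * ((2 + \<Lambda>R + \<Lambda>P) * r) * norm (vh - P vh)"
  proof -
    have "norm (P vh) \<le> (1 + \<Lambda>P) * r"
      by (rule order_trans[OF norm_P_le[OF vh] mult_left_mono[OF r(2)]])
        (use \<Lambda>_nonneg in simp)
    then have RP: "norm (R vh) + norm (P vh) \<le> (2 + \<Lambda>R + \<Lambda>P) * r"
      using R_bound[OF vh r(2)] by (simp add: algebra_simps)
    have "\<Gamma> (R vh) (R vh) y - \<Gamma> (P vh) (P vh) y
        \<le> ?g * norm (R vh - P vh) * (norm (R vh) + norm (P vh)) * norm y"
      using trilinear_diagonal_diff_bound[OF subspace_UNIV subspace_UNIV \<Gamma>_bounded,
          of "R vh" "P vh" y] by simp
    also have "\<dots> \<le> ?g * ((1 + \<Lambda>R) * norm (vh - P vh)) * ((2 + \<Lambda>R + \<Lambda>P) * r) * 1"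
      using norm_R_minus_P_le[OF vh] RP y(2) g0 r0 \<Lambda>_nonneg by (intro mult_mono) auto
    finally show ?thesis by (simp add: mult_ac)
  qed
  have "F (y - Q yh) = F y - F (Q yh)"
    by (rule linear_map_on_diff[OF linear_F subspaces(3) y(1) Qy])
  moreover have "a (P vh) (y - Q yh) = a (P vh) y - a (P vh) (Q yh)"
    by (rule linear_map_on_diff[OF linear_a2[OF Pv] subspaces(3) y(1) Qy])
  ultimately have "F y - a (P vh) y - \<Gamma> (P vh) (P vh) y = tested_residual vh y yh
      + (ah uh yh - ah vh yh) + (ah vh yh - a (P vh) (Q yh))
      + (\<Gamma> (R uh) (R uh) (S yh) - \<Gamma> (R vh) (R vh) (S yh))
      + (\<Gamma> (R vh) (R vh) y - \<Gamma> (P vh) (P vh) y)"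
    using uh(2)[OF yh(1)] by (simp add: tested_residual_def \<Gamma>_diff)
  then show ?thesis using 1 2 3 4 by (simp add: distrib_right)
qed

section \<open>Efficiency\<close>

text \<open>
  For \<open>M = 0\<close> the only test function is \<open>yh = 0\<close>, and the equation for \<open>u\<close> turns the tested
  residual into \<open>a (u - P vh) y + \<Gamma> u u y - \<Gamma> (R vh) (R vh) y\<close>.
\<close>

lemma intermediate_residual_zero_le:
  assumes u: "u \<in> X" and root: "\<And>y. y \<in> Y \<Longrightarrow> a u y + \<Gamma> u u y = F y"
    and vh: "vh \<in> Xh" and D: "norm (u - vh) \<le> D"
  shows "\<rho>res vh 0 \<le> (bilinear_norm_on X Y a * (1 + \<Lambda>P)
      + trilinear_norm_on UNIV UNIV UNIV \<Gamma> * (1 + \<Lambda>R) * (norm u + (1 + \<Lambda>R) * (norm u + D)))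
    * norm (u - vh)"
proof -
  let ?na = "bilinear_norm_on X Y a" and ?g = "trilinear_norm_on UNIV UNIV UNIV \<Gamma>"
  have na0: "0 \<le> ?na" by (rule bilinear_norm_on_nonneg[OF subspaces(1,3) a_bounded])
  have g0: "0 \<le> ?g"
    by (rule trilinear_norm_on_nonneg[OF subspace_UNIV subspace_UNIV subspace_UNIV \<Gamma>_bounded])
  have D0: "0 \<le> D" using D norm_ge_zero order_trans by blast
  have ball: "{yh \<in> Yh. norm yh \<le> 0} = {0}"
    using subspace_0[OF subspaces(4)] by auto
  have Pv: "P vh \<in> X" by (rule P_in_X[OF vh])
  have e: "u - P vh \<in> X" using u Pv subspaces(1) by (simp add: subspace_diff)
  have "norm vh \<le> norm u + D" using D norm_triangle_ineq4[of u "u - vh"] by simp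
  then have Rv: "norm (R vh) \<le> (1 + \<Lambda>R) * (norm u + D)"
    using \<Lambda>_nonneg by (intro order_trans[OF norm_R_le[OF vh] mult_left_mono]) auto
  have "tested_residual vh y 0 \<le> (?na * (1 + \<Lambda>P)
      + ?g * (1 + \<Lambda>R) * (norm u + (1 + \<Lambda>R) * (norm u + D))) * norm (u - vh)"
    if y: "y \<in> Y" "norm y \<le> 1" for y
  proof -
    have "tested_residual vh y 0 = a (u - P vh) y + (\<Gamma> u u y - \<Gamma> (R vh) (R vh) y)"
      using linear_map_on_zero[OF linear_Q subspaces(4)] linear_map_on_zero[OF linear_S subspaces(4)]
        root[OF y(1)] linear_map_on_diff[OF linear_a1[OF y(1)] subspaces(1) u Pv]
      by (simp add: tested_residual_def)
    moreover have "a (u - P vh) y \<le> ?na * ((1 + \<Lambda>P) * norm (u - vh)) * 1"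
    proof -
      have "a (u - P vh) y \<le> ?na * norm (u - P vh) * norm y"
        using abs_le_bilinear_norm_on[OF subspaces(1,3) a_bounded e y(1)] by simp
      also have "\<dots> \<le> ?na * ((1 + \<Lambda>P) * norm (u - vh)) * 1"
        using smoothed_error_P[OF vh u] y(2) na0 \<Lambda>_nonneg by (intro mult_mono) auto
      finally show ?thesis .
    qed
    moreover have "\<Gamma> u u y - \<Gamma> (R vh) (R vh) y
        \<le> ?g * ((1 + \<Lambda>R) * norm (u - vh)) * (norm u + (1 + \<Lambda>R) * (norm u + D)) * 1"
    proof -
      have "\<Gamma> u u y - \<Gamma> (R vh) (R vh) y \<le> ?g * norm (u - R vh) * (norm u + norm (R vh)) * norm y"
        using trilinear_diagonal_diff_bound[OF subspace_UNIV subspace_UNIV \<Gamma>_bounded,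
            of u "R vh" y] by simp
      also have "\<dots> \<le> ?g * ((1 + \<Lambda>R) * norm (u - vh)) * (norm u + (1 + \<Lambda>R) * (norm u + D)) * 1"
        using smoothed_error_R[OF vh u] Rv y(2) g0 D0 \<Lambda>_nonneg by (intro mult_mono) auto
      finally show ?thesis .
    qed
    ultimately show ?thesis by (simp add: algebra_simps)
  qed
  then show ?thesis
    unfolding \<rho>res_eq ball using subspace_0[OF subspaces(3)] by (intro cSUP_least) auto
qed

end

section \<open>The error estimates with explicit constants\<close>

text \<open>
  The right-hand side of the smallness condition with \<open>\<kappa>\<close> replaced by \<open>1\<close>, hence an upper bound for
  \<open>\<epsilon> + \<rho>\<close> that does not involve \<open>\<kappa>\<close>; \<open>g\<close> stands for \<open>\<parallel>\<Gamma>\<parallel>\<close>.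
\<close>

definition closeness_radius :: "real \<Rightarrow> real \<Rightarrow> real \<Rightarrow> real" where
  "closeness_radius \<beta> \<Lambda>P g = \<beta> / ((1 + \<Lambda>P) * g)"

text \<open>
  In the two constants below, \<open>k\<close> is \<open>1 / (1 - \<kappa>)\<close>, \<open>nah\<close> and \<open>na\<close> are the norms of \<open>ah\<close> and
  \<open>a\<close>, \<open>g\<close> and \<open>gpw\<close> those of \<open>\<Gamma>\<close> on the subspaces and on the whole space, \<open>s\<close> is that of
  \<open>S\<close>, and \<open>nu = \<parallel>u\<parallel>\<close>.
\<close>

definition reliability_const ::
    "real \<Rightarrow> real \<Rightarrow> real \<Rightarrow> real \<Rightarrow> real \<Rightarrow> real \<Rightarrow> real \<Rightarrow> real \<Rightarrow> real \<Rightarrow> real \<Rightarrow> real" where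
  "reliability_const \<beta> k \<Lambda>C \<Lambda>P \<Lambda>R nah g gpw s nu =
     (let r = nu + closeness_radius \<beta> \<Lambda>P g
      in 1 + k / \<beta> * (1 + (nah + gpw * s * (2 * (1 + \<Lambda>R)\<^sup>2 * r)) + \<Lambda>C
                       + gpw * (1 + \<Lambda>R) * ((2 + \<Lambda>R + \<Lambda>P) * r)))"

definition efficiency_const ::
    "real \<Rightarrow> real \<Rightarrow> real \<Rightarrow> real \<Rightarrow> real \<Rightarrow> real \<Rightarrow> real \<Rightarrow> real" where
  "efficiency_const \<Lambda>P \<Lambda>R gpw nu Cqo na D =
     na * (1 + \<Lambda>P) + gpw * (1 + \<Lambda>R) * (nu + (1 + \<Lambda>R) * (nu + D)) + \<Lambda>P + (1 + Cqo)"

text \<open>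
  Positivity of \<open>\<beta>\<close> is read off the smallness condition: its left-hand side is positive, so the
  quotient on the right is, and with it numerator and denominator.
\<close>

lemma (in semilinear_scheme) cond_L3_consequences:
  assumes L3: "cond_L3 X Y a \<Gamma> \<Lambda>P u \<epsilon> \<rho> \<kappa>"
    and pos: "0 < \<epsilon>" "0 < \<rho>" "0 < \<kappa>" "\<kappa> < 1"
  shows beta_pos: "0 < beta X Y a \<Gamma> u"
    and closeness_le_radius:
      "\<epsilon> + \<rho> \<le> closeness_radius (beta X Y a \<Gamma> u) \<Lambda>P (trilinear_norm_on X X Y \<Gamma>)"
    and quadratic_term_small:
      "trilinear_norm_on X X Y \<Gamma> * ((1 + \<Lambda>P) * (\<epsilon> + \<rho>)) \<le> \<kappa> * beta X Y a \<Gamma> u"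
proof -
  let ?\<beta> = "beta X Y a \<Gamma> u" and ?g = "trilinear_norm_on X X Y \<Gamma>"
  have g0: "0 \<le> ?g"
    by (rule trilinear_norm_on_nonneg[OF subspaces(1,1,3) \<Gamma>_restriction_bounded])
  have le: "\<epsilon> + \<rho> \<le> \<kappa> * ?\<beta> / ((1 + \<Lambda>P) * ?g)" using L3 by (simp add: cond_L3_def)
  then have "0 < \<kappa> * ?\<beta> / ((1 + \<Lambda>P) * ?g)" using pos by linarith
  moreover have den0: "0 \<le> (1 + \<Lambda>P) * ?g" using g0 \<Lambda>_nonneg by simp
  ultimately have num: "0 < \<kappa> * ?\<beta>" and den: "0 < (1 + \<Lambda>P) * ?g"
    by (auto simp: zero_less_divide_iff)
  show \<beta>: "0 < ?\<beta>" using num pos by (simp add: zero_less_mult_iff)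
  have "\<kappa> * ?\<beta> / ((1 + \<Lambda>P) * ?g) \<le> 1 * ?\<beta> / ((1 + \<Lambda>P) * ?g)"
    using \<beta> pos den by (intro divide_right_mono mult_right_mono) auto
  then show "\<epsilon> + \<rho> \<le> closeness_radius ?\<beta> \<Lambda>P ?g"
    using le by (simp add: closeness_radius_def)
  show "?g * ((1 + \<Lambda>P) * (\<epsilon> + \<rho>)) \<le> \<kappa> * ?\<beta>"
    using le den by (simp add: pos_le_divide_eq mult_ac)
qed

text \<open>
  Dividing the absorbed bound by \<open>(1 - \<kappa>) \<beta>\<close> estimates \<open>u - P vh\<close>; the triangle inequality then
  returns to \<open>u - vh\<close> at the price of one more \<open>\<parallel>vh - P vh\<parallel>\<close>, the summand \<open>1\<close> of the constant.
\<close>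

lemma (in semilinear_scheme) reliability:
  assumes u: "u \<in> X" and root: "\<And>y. y \<in> Y \<Longrightarrow> a u y + \<Gamma> u u y = F y"
    and pos: "0 < \<epsilon>" "0 < \<rho>" "0 < \<kappa>" "\<kappa> < 1" "0 \<le> M"
    and uh: "uh \<in> Xh" "\<And>yh. yh \<in> Yh \<Longrightarrow> ah uh yh + \<Gamma> (R uh) (R uh) (S yh) = F (Q yh)"
    and u_uh: "norm (u - uh) \<le> \<epsilon>"
    and vh: "vh \<in> Xh" and uh_vh: "norm (uh - vh) \<le> \<rho>"
    and L3: "cond_L3 X Y a \<Gamma> \<Lambda>P u \<epsilon> \<rho> \<kappa>" and H: "cond_H Xh Yh a ah P Q \<Lambda>C"
  shows "norm (u - vh) \<le>
    reliability_const (beta X Y a \<Gamma> u) (inverse (1 - \<kappa>)) \<Lambda>C \<Lambda>P \<Lambda>R (bilinear_norm_on Xh Yh ah)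
      (trilinear_norm_on X X Y \<Gamma>) (trilinear_norm_on UNIV UNIV UNIV \<Gamma>) (linear_norm_on Yh S) (norm u)
    * (max 0 (\<rho>res vh M) + (1 + M) * norm (vh - P vh) + M * norm (uh - vh))"
proof -
  let ?\<beta> = "beta X Y a \<Gamma> u" and ?g = "trilinear_norm_on X X Y \<Gamma>"
  let ?nah = "bilinear_norm_on Xh Yh ah" and ?gpw = "trilinear_norm_on UNIV UNIV UNIV \<Gamma>"
    and ?s = "linear_norm_on Yh S"
  let ?p = "norm (vh - P vh)" and ?d = "norm (uh - vh)"
  define r where "r = norm u + closeness_radius ?\<beta> \<Lambda>P ?g"
  define c1 where "c1 = ?nah + ?gpw * ?s * (2 * (1 + \<Lambda>R)\<^sup>2 * r)"
  define c2 where "c2 = ?gpw * (1 + \<Lambda>R) * ((2 + \<Lambda>R + \<Lambda>P) * r)"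
  define E where "E = max 0 (\<rho>res vh M) + (1 + M) * ?p + M * ?d"
  define K where "K = 1 + c1 + \<Lambda>C + c2"
  define T where "T = max 0 (\<rho>res vh M) + c1 * (M * ?d) + \<Lambda>C * (M * ?p) + c2 * ?p"
  note \<beta> = beta_pos[OF L3 pos(1-4)]
  note radius = closeness_le_radius[OF L3 pos(1-4)]
  have u_vh: "norm (u - vh) \<le> \<epsilon> + \<rho>"
    using u_uh uh_vh norm_triangle_ineq[of "u - uh" "uh - vh"] by simp
  have r: "norm uh \<le> r" "norm vh \<le> r"
    using u_uh u_vh radius pos norm_triangle_ineq4[of u "u - uh"] norm_triangle_ineq4[of u "u - vh"]
    unfolding r_def by simp_all
  have r0: "0 \<le> r" using r(1) norm_ge_zero order_trans by blast
  have nonneg: "0 \<le> ?gpw" "0 \<le> ?s" "0 \<le> ?nah" "0 \<le> ?g" "0 \<le> \<Lambda>C"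
    using trilinear_norm_on_nonneg[OF subspace_UNIV subspace_UNIV subspace_UNIV \<Gamma>_bounded]
      linear_norm_on_nonneg[OF subspaces(4) S_smoother]
      bilinear_norm_on_nonneg[OF subspaces(2,4) ah_bounded]
      trilinear_norm_on_nonneg[OF subspaces(1,1,3) \<Gamma>_restriction_bounded] H
    by (auto simp: cond_H_def)
  have c: "0 \<le> c1" "0 \<le> c2"
    unfolding c1_def c2_def using nonneg r0 \<Lambda>_nonneg by auto
  have T0: "0 \<le> T" unfolding T_def using c nonneg pos by simp
  have "(1 - \<kappa>) * ?\<beta> * norm (u - P vh) \<le> T"
  proof (rule absorbed_error_bound[OF u root P_in_X[OF vh] \<beta>])
    have "norm (u - P vh) \<le> (1 + \<Lambda>P) * (\<epsilon> + \<rho>)"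
      by (rule order_trans[OF smoothed_error_P[OF vh u] mult_left_mono[OF u_vh]])
        (use \<Lambda>_nonneg in simp)
    then have "?g * norm (u - P vh) \<le> ?g * ((1 + \<Lambda>P) * (\<epsilon> + \<rho>))"
      using nonneg by (intro mult_left_mono)
    then show "?g * norm (u - P vh) \<le> \<kappa> * ?\<beta>"
      using quadratic_term_small[OF L3 pos(1-4)] by linarith
    fix y assume y: "y \<in> Y" "norm y = 1"
    have "F y - a (P vh) y - \<Gamma> (P vh) (P vh) y - (c1 * (M * ?d) + \<Lambda>C * (M * ?p) + c2 * ?p)
        \<le> \<rho>res vh M"
    proof (rule le_intermediate_residual[OF vh pos(5) y(1)])
      fix yh assume "yh \<in> Yh" "norm yh \<le> M"
      from residual_le_consistency[OF H uh vh r y this]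
      show "F y - a (P vh) y - \<Gamma> (P vh) (P vh) y - (c1 * (M * ?d) + \<Lambda>C * (M * ?p) + c2 * ?p)
          \<le> tested_residual vh y yh"
        unfolding c1_def c2_def by linarith
    qed (use y in simp)
    then show "F y - a (P vh) y - \<Gamma> (P vh) (P vh) y \<le> T" unfolding T_def by linarith
  qed (use T0 in auto)
  also have "T \<le> K * E"
  proof -
    let ?m = "max 0 (\<rho>res vh M)"
    have E: "0 \<le> E" "?m \<le> E" "M * ?d \<le> E" "M * ?p \<le> E" "?p \<le> E"
      unfolding E_def using pos by (simp_all add: distrib_right add_increasing2)
    then have "c1 * (M * ?d) \<le> c1 * E" "\<Lambda>C * (M * ?p) \<le> \<Lambda>C * E" "c2 * ?p \<le> c2 * E"
      using c nonneg by (auto intro: mult_left_mono)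
    then show ?thesis using E(2) unfolding T_def K_def distrib_right by linarith
  qed
  finally have "norm (u - P vh) \<le> K * E / ((1 - \<kappa>) * ?\<beta>)"
    using \<beta> pos by (simp add: pos_le_divide_eq mult_ac)
  moreover have "?p \<le> E" unfolding E_def using pos by (simp add: distrib_right)
  moreover have "norm (u - vh) \<le> norm (u - P vh) + ?p"
    using norm_triangle_ineq[of "u - P vh" "P vh - vh"] by (simp add: norm_minus_commute)
  ultimately have "norm (u - vh) \<le> (1 + inverse (1 - \<kappa>) / ?\<beta> * K) * E"
    by (simp add: divide_inverse mult_ac distrib_left)
  then show ?thesis
    by (simp add: reliability_const_def Let_def r_def[symmetric] c1_def[symmetric] c2_def[symmetric]
        K_def[symmetric] E_def[symmetric])
qed

text \<open>
  Quasi-optimality enters with \<open>vh\<close> as competitor, which gives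
  \<open>\<parallel>uh - vh\<parallel> \<le> (1 + Cqo) \<parallel>u - vh\<parallel>\<close>.
\<close>

lemma (in semilinear_scheme) efficiency:
  assumes u: "u \<in> X" and root: "\<And>y. y \<in> Y \<Longrightarrow> a u y + \<Gamma> u u y = F y"
    and vh: "vh \<in> Xh" and D: "norm (u - vh) \<le> D" and QO: "cond_QO Xh u uh Cqo"
  shows "\<rho>res vh 0 + norm (vh - P vh) + norm (uh - vh) \<le>
    efficiency_const \<Lambda>P \<Lambda>R (trilinear_norm_on UNIV UNIV UNIV \<Gamma>) (norm u) Cqo
      (bilinear_norm_on X Y a) D * norm (u - vh)"
proof -
  have "(INF xh\<in>Xh. norm (u - xh)) \<le> norm (u - vh)"
    using vh by (intro cINF_lower bdd_belowI2[of _ 0]) auto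
  then have "Cqo * (INF xh\<in>Xh. norm (u - xh)) \<le> Cqo * norm (u - vh)"
    using QO by (intro mult_left_mono) (auto simp: cond_QO_def)
  then have "norm (u - uh) \<le> Cqo * norm (u - vh)"
    using QO unfolding cond_QO_def by linarith
  then have "norm (uh - vh) \<le> (1 + Cqo) * norm (u - vh)"
    using norm_triangle_ineq4[of "u - vh" "u - uh"] by (simp add: algebra_simps)
  then show ?thesis
    using intermediate_residual_zero_le[OF u root vh D] SP[OF vh u]
    by (simp add: efficiency_const_def distrib_right)
qed

text \<open>
  The two efficiency constants differ only in the bound used for \<open>\<parallel>u - vh\<parallel>\<close> inside the nonlinear
  factor: the closeness radius where the smallness condition is available, \<open>\<epsilon> + \<rho>\<close> itself
  otherwise.
\<close>

theorem theorem2p1: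
  "\<exists>(Crel :: real \<Rightarrow> real \<Rightarrow> real \<Rightarrow> real \<Rightarrow> real \<Rightarrow> real \<Rightarrow> real \<Rightarrow> real \<Rightarrow> real \<Rightarrow> real \<Rightarrow> real)
    (Ceff :: real \<Rightarrow> real \<Rightarrow> real \<Rightarrow> real \<Rightarrow> real \<Rightarrow> real \<Rightarrow> real \<Rightarrow> real \<Rightarrow> real \<Rightarrow> real \<Rightarrow> real
       \<Rightarrow> real \<Rightarrow> real)
    (Ceff' :: real \<Rightarrow> real \<Rightarrow> real \<Rightarrow> real \<Rightarrow> real \<Rightarrow> real \<Rightarrow> real \<Rightarrow> real \<Rightarrow> real \<Rightarrow> real \<Rightarrow> real
       \<Rightarrow> real \<Rightarrow> real \<Rightarrow> real).
   \<forall>(X :: 'x::banach set) Xh (Y :: 'y::banach set) Yh a \<Gamma> F ah P Q R S \<Lambda>P \<Lambda>Q \<Lambda>R \<Lambda>S \<Lambda>C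
      u uh vh \<epsilon> \<rho> \<kappa> M.
     semilinear_scheme X Xh Y Yh a \<Gamma> F ah P Q R S \<Lambda>P \<Lambda>Q \<Lambda>R \<Lambda>S \<longrightarrow>
     regular_root X Y (residual Y a \<Gamma> F) u \<longrightarrow>
     0 < \<epsilon> \<longrightarrow> 0 < \<rho> \<longrightarrow> 0 < \<kappa> \<longrightarrow> \<kappa> < 1 \<longrightarrow> 0 \<le> M \<longrightarrow>
     cond_L1 Xh Yh (discrete_residual Yh ah \<Gamma> F Q R S) u uh \<epsilon> \<longrightarrow>
     cond_L2 Xh uh vh \<rho> \<longrightarrow>
     (cond_L3 X Y a \<Gamma> \<Lambda>P u \<epsilon> \<rho> \<kappa> \<longrightarrow> cond_H Xh Yh a ah P Q \<Lambda>C \<longrightarrow>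
        norm (u - vh) \<le>
          Crel (beta X Y a \<Gamma> u) (inverse (1 - \<kappa>)) \<Lambda>C \<Lambda>P \<Lambda>R (bilinear_norm_on Xh Yh ah)
               (trilinear_norm_on X X Y \<Gamma>) (trilinear_norm_on UNIV UNIV UNIV \<Gamma>)
               (linear_norm_on Yh S) (norm u)
          * (max 0 (intermediate_residual Y Yh a \<Gamma> F P Q R S vh M)
             + (1 + M) * norm (vh - P vh) + M * norm (uh - vh)))
     \<and>
     (\<forall>Cqo. cond_QO Xh u uh Cqo \<longrightarrow>
        intermediate_residual Y Yh a \<Gamma> F P Q R S vh M
          \<le> intermediate_residual Y Yh a \<Gamma> F P Q R S vh 0
        \<and>
        (cond_L3 X Y a \<Gamma> \<Lambda>P u \<epsilon> \<rho> \<kappa> \<longrightarrow>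
           intermediate_residual Y Yh a \<Gamma> F P Q R S vh 0 + norm (vh - P vh) + norm (uh - vh) \<le>
             Ceff (beta X Y a \<Gamma> u) (inverse (1 - \<kappa>)) \<Lambda>C \<Lambda>P \<Lambda>R (bilinear_norm_on Xh Yh ah)
                  (trilinear_norm_on X X Y \<Gamma>) (trilinear_norm_on UNIV UNIV UNIV \<Gamma>)
                  (linear_norm_on Yh S) (norm u) Cqo
                  (bilinear_norm_on X Y a)
             * norm (u - vh))
        \<and>
        intermediate_residual Y Yh a \<Gamma> F P Q R S vh 0 + norm (vh - P vh) + norm (uh - vh) \<le>
          Ceff' (beta X Y a \<Gamma> u) (inverse (1 - \<kappa>)) \<Lambda>C \<Lambda>P \<Lambda>R (bilinear_norm_on Xh Yh ah)
                (trilinear_norm_on X X Y \<Gamma>) (trilinear_norm_on UNIV UNIV UNIV \<Gamma>)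
                (linear_norm_on Yh S) (norm u) Cqo
                (bilinear_norm_on X Y a) (\<epsilon> + \<rho>)
          * norm (u - vh))"
proof (rule exI[of _ reliability_const],
    rule exI[of _ "\<lambda>\<beta> k \<Lambda>C \<Lambda>P \<Lambda>R nah g gpw s nu Cqo na.
      efficiency_const \<Lambda>P \<Lambda>R gpw nu Cqo na (closeness_radius \<beta> \<Lambda>P g)"],
    rule exI[of _ "\<lambda>\<beta> k \<Lambda>C \<Lambda>P \<Lambda>R nah g gpw s nu Cqo na D.
      efficiency_const \<Lambda>P \<Lambda>R gpw nu Cqo na D"],
    intro allI impI, goal_cases)
  case (1 X Xh Y Yh a \<Gamma> F ah P Q R S \<Lambda>P \<Lambda>Q \<Lambda>R \<Lambda>S \<Lambda>C u uh vh \<epsilon> \<rho> \<kappa> M)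
  interpret semilinear_scheme X Xh Y Yh a \<Gamma> F ah P Q R S \<Lambda>P \<Lambda>Q \<Lambda>R \<Lambda>S
    by (rule 1(1))
  note pos = 1(3-7)
  have u: "u \<in> X" using 1(2) by (simp add: regular_root_def)
  have root: "a u y + \<Gamma> u u y = F y" if "y \<in> Y" for y
    using 1(2) that by (auto simp: regular_root_def residual_def)
  have uh: "uh \<in> Xh" and u_uh: "norm (u - uh) \<le> \<epsilon>"
    using 1(8) by (auto simp: cond_L1_def Let_def)
  have uh_root: "ah uh yh + \<Gamma> (R uh) (R uh) (S yh) = F (Q yh)" if "yh \<in> Yh" for yh
    using 1(8) that by (auto simp: cond_L1_def Let_def discrete_residual_def)
  have vh: "vh \<in> Xh" and uh_vh: "norm (uh - vh) \<le> \<rho>"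
    using 1(9) by (auto simp: cond_L2_def)
  have u_vh: "norm (u - vh) \<le> \<epsilon> + \<rho>"
    using u_uh uh_vh norm_triangle_ineq[of "u - uh" "uh - vh"] by simp
  show ?case
  proof (intro conjI allI impI)
    assume "cond_L3 X Y a \<Gamma> \<Lambda>P u \<epsilon> \<rho> \<kappa>" "cond_H Xh Yh a ah P Q \<Lambda>C"
    then show "norm (u - vh) \<le>
        reliability_const (beta X Y a \<Gamma> u) (inverse (1 - \<kappa>)) \<Lambda>C \<Lambda>P \<Lambda>R (bilinear_norm_on Xh Yh ah)
          (trilinear_norm_on X X Y \<Gamma>) (trilinear_norm_on UNIV UNIV UNIV \<Gamma>) (linear_norm_on Yh S)
          (norm u)
        * (max 0 (\<rho>res vh M) + (1 + M) * norm (vh - P vh) + M * norm (uh - vh))"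
      by (intro reliability[OF u root pos uh uh_root u_uh vh uh_vh])
  next
    show "\<rho>res vh M \<le> \<rho>res vh 0"
      using intermediate_residual_antimono[OF vh _ pos(5)] by simp
  next
    fix Cqo
    assume QO: "cond_QO Xh u uh Cqo" and L3: "cond_L3 X Y a \<Gamma> \<Lambda>P u \<epsilon> \<rho> \<kappa>"
    show "\<rho>res vh 0 + norm (vh - P vh) + norm (uh - vh) \<le>
        efficiency_const \<Lambda>P \<Lambda>R (trilinear_norm_on UNIV UNIV UNIV \<Gamma>) (norm u) Cqo
          (bilinear_norm_on X Y a)
          (closeness_radius (beta X Y a \<Gamma> u) \<Lambda>P (trilinear_norm_on X X Y \<Gamma>)) * norm (u - vh)"
      using u_vh closeness_le_radius[OF L3 pos(1-4)]
      by (intro efficiency[OF u root vh _ QO]) auto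
  next
    fix Cqo
    assume QO: "cond_QO Xh u uh Cqo"
    show "\<rho>res vh 0 + norm (vh - P vh) + norm (uh - vh) \<le>
        efficiency_const \<Lambda>P \<Lambda>R (trilinear_norm_on UNIV UNIV UNIV \<Gamma>) (norm u) Cqo
          (bilinear_norm_on X Y a) (\<epsilon> + \<rho>) * norm (u - vh)"
      by (rule efficiency[OF u root vh u_vh QO])
  qed
qed

end
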